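(* Let $n\in\{0,1,2,\dots\}$ and let $\{\theta_k\}_{k=1}^n$ be a finite sequence of rational multiples of $\pi$ from the interval $(0,\pi)$ such that $$d(\theta_k)\nmid\operatorname{lcm}(d(\theta_1),\dots,d(\theta_{k-1}))$$ for $2\leq k\leq n$. Let $\theta_{n+1}\in(0,\pi)$ be an irrational multiple of $\pi$. Set $E=\{\theta_k:\ 1\leq k\leq n+1\}$ and define $\eta:E\to\mathbb{Z}^+$ by $\eta(\theta_1)=1$ and $$\eta(\theta_k)=\operatorname{lcm}(d(\theta_1),\dots,d(\theta_{k-1}))$$ for $2\leq k\leq n+1$. Then $(E,\eta)$ is an admissible function of angles.
   Context: $\mathbb{Z}^+=\{1,2,3,\dots\}$. For $\theta\in\mathbb{R}$ the set $\mathcal{I}(\theta)=\{m\in\mathbb{Z}:\sin(m\theta)=0\}$ is an ideal in $\mathbb{Z}$, and $d(\theta)\geq0$ denotes its unique non-negative generator: $\mathcal{I}(\theta)=d(\theta)\mathbb{Z}$. (Thus $d(\theta)=0$ iff $\theta$ is not a rational multiple of $\pi$, and $d(\frac rs\pi)=s$ if $r\in\mathbb{Z}$, $s\in\mathbb{Z}^+$ are relatively prime.) $\operatorname{lcm}$ denotes the least common multiple, i.e. the non-negative generator of the intersection of the ideals generated by the given integers. The case $n=0$ (empty sequence) is allowed; then $E=\{\theta_1\}$ with $\theta_1$ an irrational multiple of $\pi$ and $\eta(\theta_1)=1$. An admissible function of angles is a pair $(E,\eta)$ with $E\subset(0,\pi)$ a set and $\eta:E\to\mathbb{Z}^+$ a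 function such that for every $k\in\mathbb{Z}^+$ there exists $\theta\in E$ with $\sin(k\theta)\neq0$ and $k\geq\eta(\theta)$. *)

theory Defs
  imports Complex_Main
begin

definition sin_zeros :: "real \<Rightarrow> int set" where
  "sin_zeros \<theta> = {m. sin (of_int m * \<theta>) = 0}"

definition angle_gen :: "real \<Rightarrow> nat" where
  "angle_gen \<theta> = (THE d. sin_zeros \<theta> = range (\<lambda>m. int d * m))"

lemma sin_zeros_diff:
  assumes "a \<in> sin_zeros \<theta>" "b \<in> sin_zeros \<theta>"
  shows "a - b \<in> sin_zeros \<theta>"
  using assms by (simp add: sin_zeros_def left_diff_distrib sin_diff)

lemma sin_zeros_mult:
  assumes "a \<in> sin_zeros \<theta>"
  shows "a * m \<in> sin_zeros \<theta>"
proof -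
  obtain i :: int where "of_int a * \<theta> = of_int i * pi"
    using assms by (auto simp: sin_zeros_def sin_zero_iff_int2)
  then have "of_int (a * m) * \<theta> = of_int (i * m) * pi"
    by (simp add: algebra_simps)
  then show ?thesis
    unfolding sin_zeros_def sin_zero_iff_int2 by blast
qed

lemma sin_zeros_generator: "\<exists>!d. sin_zeros \<theta> = range (\<lambda>m. int d * m)"
proof (rule ex_ex1I)
  show "\<exists>d. sin_zeros \<theta> = range (\<lambda>m. int d * m)"
  proof (cases "\<exists>d::nat. 0 < d \<and> int d \<in> sin_zeros \<theta>")
    case True
    define d where "d = (LEAST d::nat. 0 < d \<and> int d \<in> sin_zeros \<theta>)"
    have d: "0 < d" "int d \<in> sin_zeros \<theta>"
      using LeastI_ex[OF True] by (auto simp: d_def)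
    have "m \<in> range (\<lambda>m. int d * m)" if m: "m \<in> sin_zeros \<theta>" for m
    proof -
      have "m mod int d \<in> sin_zeros \<theta>"
        using sin_zeros_diff[OF m sin_zeros_mult[OF d(2), of "m div int d"]]
        by (simp add: minus_mult_div_eq_mod)
      moreover have "0 \<le> m mod int d" "m mod int d < int d"
        using d(1) by auto
      ultimately have "m mod int d = 0"
        using not_less_Least[of "nat (m mod int d)"
            "\<lambda>d. 0 < d \<and> int d \<in> sin_zeros \<theta>", folded d_def]
        by (auto simp: nat_less_iff)
      then show ?thesis by (auto elim: dvdE)
    qed
    then show ?thesis using sin_zeros_mult[OF d(2)] by blast
  next
    case False
    have "m = 0" if m: "m \<in> sin_zeros \<theta>" for m
    proof (rule ccontr)
      assume "m \<noteq> 0"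
      moreover have "int (nat \<bar>m\<bar>) \<in> sin_zeros \<theta>"
        using m sin_zeros_mult[OF m, of "-1"] by (simp add: abs_if)
      ultimately show False using False by (metis zero_less_abs_iff zero_less_nat_eq)
    qed
    then have "sin_zeros \<theta> = range (\<lambda>m. int 0 * m)" by (auto simp: sin_zeros_def)
    then show ?thesis by blast
  qed
next
  fix d e :: nat
  assume d: "sin_zeros \<theta> = range (\<lambda>m. int d * m)"
    and e: "sin_zeros \<theta> = range (\<lambda>m. int e * m)"
  have "int d * 1 \<in> sin_zeros \<theta>" "int e * 1 \<in> sin_zeros \<theta>"
    using d e by blast+
  then have "int e dvd int d" "int d dvd int e"
    using d e by (metis dvd_triv_left imageE mult.right_neutral)+
  then show "d = e" by (simp add: dvd_antisym)
qed

lemma sin_zeros_eq: "sin_zeros \<theta> = range (\<lambda>m. int (angle_gen \<theta>) * m)"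
  unfolding angle_gen_def by (rule theI'[OF sin_zeros_generator])

definition admissible_angles :: "real set \<Rightarrow> (real \<Rightarrow> nat) \<Rightarrow> bool" where
  "admissible_angles E \<eta> \<longleftrightarrow>
     E \<subseteq> {0<..<pi} \<and> (\<forall>\<theta>\<in>E. 1 \<le> \<eta> \<theta>) \<and>
     (\<forall>k::nat. 1 \<le> k \<longrightarrow> (\<exists>\<theta>\<in>E. sin (real k * \<theta>) \<noteq> 0 \<and> \<eta> \<theta> \<le> k))"

text \<open>
  The weights prescribed along the sequence of angles. As \<open>\<eta>\<close> is a function of the angle
  and not of its index, such an \<open>\<eta>\<close> exists only if repeated angles get equal weights.
\<close>
definition lcm_weights :: "nat \<Rightarrow> (nat \<Rightarrow> real) \<Rightarrow> (real \<Rightarrow> nat) \<Rightarrow> bool" where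
  "lcm_weights n \<theta> \<eta> \<longleftrightarrow>
     \<eta> (\<theta> 1) = 1 \<and>
     (\<forall>k\<in>{2..n+1}. \<eta> (\<theta> k) = (LCM i\<in>{1..<k}. angle_gen (\<theta> i)))"

end

theory Submission
  imports Defs
begin

text \<open>
  For given \<open>k\<close> take the least index \<open>j\<close> with \<open>sin (k * \<theta> j) \<noteq> 0\<close>; it exists because the last
  angle is an irrational multiple of \<open>pi\<close>. All earlier generators divide \<open>k\<close>, hence so does
  their least common multiple \<open>\<eta> (\<theta> j)\<close>, which is therefore at most \<open>k\<close>.
  The non-divisibility hypothesis serves only to make the angles distinct, so that the
  weights are well defined.
\<close>

lemma sin_mult_eq_0_iff_angle_gen_dvd:
  "sin (real k * \<theta>) = 0 \<longleftrightarrow> angle_gen \<theta> dvd k"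
proof -
  have "sin (real k * \<theta>) = 0 \<longleftrightarrow> int k \<in> sin_zeros \<theta>"
    by (simp add: sin_zeros_def)
  also have "\<dots> \<longleftrightarrow> int (angle_gen \<theta>) dvd int k"
    by (subst sin_zeros_eq) (auto simp: dvd_def)
  finally show ?thesis by simp
qed

text \<open>A positive generator is itself a zero, which exhibits \<open>\<theta> / pi\<close> as a
  fraction; conversely, a denominator of \<open>\<theta> / pi\<close> is a positive element of the
  ideal, so the generator cannot be 0.\<close>

lemma angle_gen_pos_iff: "0 < angle_gen \<theta> \<longleftrightarrow> \<theta> / pi \<in> \<rat>"
proof
  assume pos: "0 < angle_gen \<theta>"
  have "sin (real (angle_gen \<theta>) * \<theta>) = 0"
    by (simp add: sin_mult_eq_0_iff_angle_gen_dvd)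
  then obtain i :: int where "real (angle_gen \<theta>) * \<theta> = of_int i * pi"
    by (auto simp: sin_zero_iff_int2)
  then have "\<theta> / pi = of_int i / of_nat (angle_gen \<theta>)"
    using pos by (simp add: field_simps)
  then show "\<theta> / pi \<in> \<rat>" by simp
next
  assume "\<theta> / pi \<in> \<rat>"
  then obtain a b :: int where b: "0 < b" and ab: "\<theta> / pi = of_int a / of_int b"
    by (auto elim: Rats_cases')
  then have "real (nat b) * \<theta> = of_int a * pi"
    by (simp add: field_simps)
  then have "sin (real (nat b) * \<theta>) = 0"
    by (auto simp: sin_zero_iff_int2)
  then have "angle_gen \<theta> dvd nat b"
    by (simp only: sin_mult_eq_0_iff_angle_gen_dvd)
  moreover have "0 < nat b" using b by simp
  ultimately show "0 < angle_gen \<theta>" by (rule dvd_pos_nat[rotated])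
qed

text \<open>The empty \<open>LCM\<close> is 1, so the separate clause for the first angle is the
  case \<open>k = 1\<close> of the general formula.\<close>

lemma lcm_weights_iff:
  "lcm_weights n \<theta> \<eta> \<longleftrightarrow>
    (\<forall>k\<in>{1..n+1}. \<eta> (\<theta> k) = (LCM i\<in>{1..<k}. angle_gen (\<theta> i)))"
proof -
  have "{1..n+1} = insert 1 {2..n+1}" by auto
  then show ?thesis by (simp add: lcm_weights_def)
qed

theorem theorem9p2:
  fixes n :: nat and \<theta> :: "nat \<Rightarrow> real"
  assumes "\<And>k. k \<in> {1..n} \<Longrightarrow> \<theta> k \<in> {0<..<pi} \<and> \<theta> k / pi \<in> \<rat>"
    and "\<And>k. k \<in> {2..n} \<Longrightarrow> \<not> angle_gen (\<theta> k) dvd (LCM i\<in>{1..<k}. angle_gen (\<theta> i))"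
    and "\<theta> (n+1) \<in> {0<..<pi}" and "\<theta> (n+1) / pi \<notin> \<rat>"
  shows "(\<exists>\<eta>. lcm_weights n \<theta> \<eta>) \<and>
    (\<forall>\<eta>. lcm_weights n \<theta> \<eta> \<longrightarrow> admissible_angles (\<theta> ` {1..n+1}) \<eta>)"
proof (intro conjI allI impI)
  define L where "L k = (LCM i\<in>{1..<k}. angle_gen (\<theta> i))" for k
  \<comment> \<open>For \<open>j = n + 1\<close> rationality separates the angles. Otherwise
    \<open>2 \<le> j \<le> n\<close>, and equal angles would make the generator of
    \<open>\<theta> j\<close> one of those whose multiple is \<open>L j\<close>.\<close>
  have "\<theta> i \<noteq> \<theta> j" if "i \<in> {1..n+1}" "j \<in> {1..n+1}" "i < j" for i j
  proof (cases "j = n + 1")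
    case True
    then show ?thesis using assms(1)[of i] assms(4) that by auto
  next
    case False
    have "angle_gen (\<theta> i) dvd L j" using that by (auto simp: L_def)
    moreover have "\<not> angle_gen (\<theta> j) dvd L j"
      using assms(2)[of j] that False by (auto simp: L_def)
    ultimately show ?thesis by auto
  qed
  then have "inj_on \<theta> {1..n+1}" by (rule linorder_inj_onI') auto
  then have "lcm_weights n \<theta> (L \<circ> inv_into {1..n+1} \<theta>)"
    unfolding lcm_weights_iff L_def[symmetric] by (simp del: Suc_eq_plus1 add: inv_into_f_f)
  then show "\<exists>\<eta>. lcm_weights n \<theta> \<eta>" by blast

  fix \<eta>
  assume "lcm_weights n \<theta> \<eta>"
  then have \<eta>: "\<eta> (\<theta> k) = L k" if "k \<in> {1..n+1}" for k
    using that unfolding lcm_weights_iff L_def by blast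
  have "1 \<le> L k" if "k \<in> {1..n+1}" for k
  proof -
    \<comment> \<open>Since \<open>i < k \<le> n + 1\<close>, only rational multiples of
      \<open>pi\<close> enter \<open>L k\<close>, even for the last weight.\<close>
    have "0 < angle_gen (\<theta> i)" if "i \<in> {1..<k}" for i
      using assms(1)[of i] that \<open>k \<in> {1..n+1}\<close> by (auto simp: angle_gen_pos_iff)
    then have "0 \<notin> (\<lambda>i. angle_gen (\<theta> i)) ` {1..<k}" by force
    then have "L k \<noteq> 0" unfolding L_def by (subst Lcm_0_iff) auto
    then show ?thesis by simp
  qed
  moreover have "\<theta> ` {1..n+1} \<subseteq> {0<..<pi}"
  proof -
    have "{1..n+1} = insert (n+1) {1..n}" by auto
    then show ?thesis using assms(1,3) by auto
  qed
  moreover have "\<exists>j\<in>{1..n+1}. sin (real k * \<theta> j) \<noteq> 0 \<and> L j \<le> k" if "1 \<le> k" for k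
  proof -
    \<comment> \<open>The conjunct \<open>1 \<le> j\<close> keeps the least index away from the
      unconstrained value \<open>\<theta> 0\<close>.\<close>
    define P where "P j \<longleftrightarrow> 1 \<le> j \<and> sin (real k * \<theta> j) \<noteq> 0" for j
    define j where "j = (LEAST j. P j)"
    \<comment> \<open>Generator 0 divides only 0, so no \<open>k \<ge> 1\<close> makes the sine
      vanish at the last angle.\<close>
    have "angle_gen (\<theta> (n+1)) = 0"
      using angle_gen_pos_iff assms(4) by blast
    then have last: "P (n+1)"
      using that by (simp add: P_def sin_mult_eq_0_iff_angle_gen_dvd)
    then have "P j" "j \<le> n + 1"
      unfolding j_def by (rule LeastI, rule Least_le)
    have "angle_gen (\<theta> i) dvd k" if "i \<in> {1..<j}" for i
      using not_less_Least[of i P] that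
      by (simp add: P_def j_def sin_mult_eq_0_iff_angle_gen_dvd)
    then have "L j dvd k" unfolding L_def by (auto intro: Lcm_least)
    then have "L j \<le> k" using that by (auto intro: dvd_imp_le)
    with \<open>P j\<close> \<open>j \<le> n + 1\<close> show ?thesis by (auto simp: P_def)
  qed
  ultimately show "admissible_angles (\<theta> ` {1..n+1}) \<eta>"
    unfolding admissible_angles_def using \<eta> by fastforce
qed

end
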